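(* Let $\alpha\ge1$ and $\delta\ge0$. Let $\mu_1,\mu_2$ be sub-distributions over countable sets $A_1,A_2$ with equal weight ($\mu_1(A_1)=\mu_2(A_2)$), and let $S_1\subseteq A_1$, $S_2\subseteq A_2$. Then $\mu_1(S_1)\le\alpha\mu_2(S_2)+\delta$ and $\mu_1(A_1\setminus S_1)\le\alpha\mu_2(A_2\setminus S_2)+\delta$ both hold if and only if there is an $(\ln\alpha,\delta)$-approximate lifting of $\{(a_1,a_2): a_1\in S_1\Leftrightarrow a_2\in S_2\}$ relating $\mu_1$ and $\mu_2$.
   Context: A sub-distribution over a countable set $A$ is $\mu:A\to[0,1]$ with $\sum_a\mu(a)\le1$; $\mu(X)=\sum_{a\in X}\mu(a)$; marginals of $\mu$ over $A_1\times A_2$ are $\pi_1(\mu)(a_1)=\sum_{a_2}\mu(a_1,a_2)$, $\pi_2(\mu)(a_2)=\sum_{a_1}\mu(a_1,a_2)$. $d_\varepsilon(\nu_1,\nu_2)=\max_{X}(\nu_1(X)-e^{\varepsilon}\nu_2(X))$. With a fresh element $\star$, $A^\star=A\cup\{\star\}$ and $Q^\star=Q\cup(A_1\times\{\star\})\cup(\{\star\}\times A_2)$ for $Q\subseteq A_1\times A_2$. An $(\varepsilon,\delta)$-approximate $Q$-lifting of $(\mu_1,\mu_2)$ exists if there are sub-distributions $\mu_L,\mu_R$ over $A_1^\star\times A_2^\star$ with $\pi_1(\mu_L)=\mu_1$, $\pi_2(\mu_R)=\mu_2$ (with $\mu_i(\star)=0$), $\mathrm{supp}(\mu_L)\cup\mathrm{supp}(\mu_R)\subseteq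 Q^\star$, and $d_\varepsilon(\mu_L,\mu_R)\le\delta$. *)

theory Defs
  imports "HOL-Probability.SPMF"
begin

text \<open>
  A sub-distribution over a countable set A is an spmf whose support lies in A; the mass function
  is \<open>spmf \<mu>\<close>, the mass of a set X is \<open>measure (measure_spmf \<mu>) X\<close>, and the two marginals are
  \<open>map_spmf fst\<close> and \<open>map_spmf snd\<close>.
\<close>

definition subdist_on :: "'a set \<Rightarrow> 'a spmf \<Rightarrow> bool" where
  "subdist_on A \<mu> \<longleftrightarrow> set_spmf \<mu> \<subseteq> A"

text \<open>
  The supremum below is over a nonempty set of reals bounded above by 1. For sub-distributions
  over A it is attained, at the set of those x with \<open>spmf \<nu>1 x > exp \<epsilon> * spmf \<nu>2 x\<close>.
\<close>

definition eps_dist :: "'a set \<Rightarrow> real \<Rightarrow> 'a spmf \<Rightarrow> 'a spmf \<Rightarrow> real" where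
  "eps_dist A \<epsilon> \<nu>1 \<nu>2 =
     (SUP X\<in>Pow A. measure (measure_spmf \<nu>1) X - exp \<epsilon> * measure (measure_spmf \<nu>2) X)"

text \<open>
  The fresh element is \<open>None\<close> and elements of A are embedded by \<open>Some\<close>. It is unrelated to the
  \<open>None\<close> inside the type \<open>'a spmf = 'a option pmf\<close>, which carries the missing mass.
\<close>

definition star_set :: "'a set \<Rightarrow> 'a option set" where
  "star_set A = Some ` A \<union> {None}"

definition star_rel :: "'a set \<Rightarrow> 'b set \<Rightarrow> ('a \<times> 'b) set \<Rightarrow> ('a option \<times> 'b option) set" where
  "star_rel A1 A2 Q =
     map_prod Some Some ` Q \<union> (Some ` A1) \<times> {None} \<union> {None} \<times> (Some ` A2)"

text \<open>
  \<open>map_spmf Some \<mu>\<close> is the sub-distribution \<mu> extended by mass 0 at the fresh element.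
\<close>

definition approx_lifting ::
  "'a set \<Rightarrow> 'b set \<Rightarrow> real \<Rightarrow> real \<Rightarrow> ('a \<times> 'b) set \<Rightarrow> 'a spmf \<Rightarrow> 'b spmf \<Rightarrow> bool" where
  "approx_lifting A1 A2 \<epsilon> \<delta> Q \<mu>1 \<mu>2 \<longleftrightarrow>
     (\<exists>\<mu>L \<mu>R.
        subdist_on (star_set A1 \<times> star_set A2) \<mu>L \<and>
        subdist_on (star_set A1 \<times> star_set A2) \<mu>R \<and>
        map_spmf fst \<mu>L = map_spmf Some \<mu>1 \<and>
        map_spmf snd \<mu>R = map_spmf Some \<mu>2 \<and>
        set_spmf \<mu>L \<union> set_spmf \<mu>R \<subseteq> star_rel A1 A2 Q \<and>
        eps_dist (star_set A1 \<times> star_set A2) \<epsilon> \<mu>L \<mu>R \<le> \<delta>)"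

end

theory Submission
  imports Defs
begin

text \<open>
  If a lifting exists, evaluate the distance on the rows indexed by a set \<open>P\<close>: there the left
  witness has mass \<open>\<mu>1(P)\<close>, while the right witness has no mass in the column \<open>None\<close> and hence
  at most \<open>\<mu>2(T)\<close> when \<open>T\<close> contains the image of \<open>P\<close> under the relation.

  Conversely, on each of the two blocks \<open>S1 \<times> S2\<close> and \<open>(A1 - S1) \<times> (A2 - S2)\<close>, with masses \<open>p\<close>
  and \<open>q\<close> on the two sides, put \<open>r = 1 / max p (\<alpha> * q)\<close> and let the witnesses have densities
  \<open>\<alpha> * r * \<mu>1(a) * \<mu>2(b)\<close> and \<open>r * \<mu>1(a) * \<mu>2(b)\<close>, the rest of each marginal being sent to the
  fresh element (if \<open>p = q = 0\<close> then \<open>r = 1 / 0 = 0\<close>, which is harmless).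
  The distance is then at most the mass the left witness sends there, which is
  \<open>max (p - \<alpha> * q) 0\<close> on each block. As the weights agree and \<open>\<alpha> \<ge> 1\<close>, the two differences
  have a sum of at most 0, so they are not both positive and the total is at most \<open>\<delta>\<close>.
\<close>

section \<open>Bounds on the distance and on masses of sets\<close>

lemma eps_dist_upper:
  assumes "X \<subseteq> A"
  shows "measure (measure_spmf \<nu>1) X - exp \<epsilon> * measure (measure_spmf \<nu>2) X \<le> eps_dist A \<epsilon> \<nu>1 \<nu>2"
  unfolding eps_dist_def
proof (rule cSUP_upper)
  show "bdd_above ((\<lambda>X. measure (measure_spmf \<nu>1) X - exp \<epsilon> * measure (measure_spmf \<nu>2) X) ` Pow A)"
  proof (rule bdd_aboveI2)
    fix X
    have "measure (measure_spmf \<nu>1) X \<le> 1"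
      by (rule measure_spmf.subprob_measure_le_1)
    moreover have "0 \<le> exp \<epsilon> * measure (measure_spmf \<nu>2) X"
      by simp
    ultimately show "measure (measure_spmf \<nu>1) X - exp \<epsilon> * measure (measure_spmf \<nu>2) X \<le> 1"
      by linarith
  qed
qed (use assms in simp)

lemma eps_dist_least:
  assumes "\<And>X. X \<subseteq> A \<Longrightarrow>
    measure (measure_spmf \<nu>1) X \<le> exp \<epsilon> * measure (measure_spmf \<nu>2) X + \<delta>"
  shows "eps_dist A \<epsilon> \<nu>1 \<nu>2 \<le> \<delta>"
  unfolding eps_dist_def by (rule cSUP_least) (auto dest: assms simp: algebra_simps)

lemma measure_spmf_mono_on_support:
  assumes "\<And>x. x \<in> set_spmf \<mu> \<Longrightarrow> x \<in> X \<Longrightarrow> x \<in> Y"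
  shows "measure (measure_spmf \<mu>) X \<le> measure (measure_spmf \<mu>) Y"
  by (rule measure_spmf.finite_measure_mono_AE) (use assms in auto)

text \<open>Both masses are integrals of point masses against the counting measure, so the bound can
  be checked under the integral; extended nonnegative values avoid summability conditions.\<close>

lemma measure_spmf_le_of_spmf_le:
  assumes le: "\<And>x. x \<in> X \<Longrightarrow> spmf p x \<le> c * spmf q x" and "0 \<le> c"
  shows "measure (measure_spmf p) X \<le> c * measure (measure_spmf q) X"
proof -
  have "emeasure (measure_spmf p) X = (\<integral>\<^sup>+ x. ennreal (spmf p x) \<partial>count_space X)"
    by (simp add: nn_integral_spmf)
  also have "\<dots> \<le> (\<integral>\<^sup>+ x. ennreal c * ennreal (spmf q x) \<partial>count_space X)"
    using le \<open>0 \<le> c\<close> by (intro nn_integral_mono) (auto simp: ennreal_mult[symmetric])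
  also have "\<dots> = ennreal c * emeasure (measure_spmf q) X"
    by (simp add: nn_integral_cmult nn_integral_spmf)
  finally show ?thesis
    using \<open>0 \<le> c\<close> by (simp add: measure_spmf.emeasure_eq_measure ennreal_mult[symmetric])
qed

section \<open>From a lifting to an inequality of masses\<close>

lemma approx_lifting_measure_le:
  assumes lift: "approx_lifting A1 A2 \<epsilon> \<delta> Q \<mu>1 \<mu>2"
    and "P \<subseteq> A1" and "T \<subseteq> A2"
    and image: "\<And>a b. (a, b) \<in> Q \<Longrightarrow> a \<in> P \<Longrightarrow> b \<in> T"
  shows "measure (measure_spmf \<mu>1) P \<le> exp \<epsilon> * measure (measure_spmf \<mu>2) T + \<delta>"
proof -
  obtain \<mu>L \<mu>R where
    marg: "map_spmf fst \<mu>L = map_spmf Some \<mu>1" "map_spmf snd \<mu>R = map_spmf Some \<mu>2"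
    and supp: "set_spmf \<mu>L \<union> set_spmf \<mu>R \<subseteq> star_rel A1 A2 Q"
    and dist: "eps_dist (star_set A1 \<times> star_set A2) \<epsilon> \<mu>L \<mu>R \<le> \<delta>"
    using lift unfolding approx_lifting_def by blast
  \<comment> \<open>The column \<open>None\<close> has to belong to \<open>X\<close>, since the left
    witness may send mass of \<open>P\<close> there. It costs nothing on the right, where the second
    marginal vanishes at \<open>None\<close>.\<close>
  define X where "X = Some ` P \<times> (Some ` T \<union> {None})"
  have "measure (measure_spmf \<mu>1) P = measure (measure_spmf (map_spmf Some \<mu>1)) (Some ` P)"
    by (simp add: measure_map_spmf inj_vimage_image_eq)
  also have "\<dots> = measure (measure_spmf \<mu>L) (fst -` Some ` P)"
    by (simp add: marg(1)[symmetric] measure_map_spmf)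
  also have "\<dots> \<le> measure (measure_spmf \<mu>L) X"
  proof (rule measure_spmf_mono_on_support)
    fix z assume "z \<in> set_spmf \<mu>L" and z: "z \<in> fst -` Some ` P"
    then have "z \<in> star_rel A1 A2 Q"
      using supp by blast
    then show "z \<in> X"
      using z by (auto simp: X_def star_rel_def dest: image)
  qed
  finally have left: "measure (measure_spmf \<mu>1) P \<le> measure (measure_spmf \<mu>L) X" .
  have no_None: "snd z \<noteq> None" if "z \<in> set_spmf \<mu>R" for z
  proof
    assume "snd z = None"
    then have "None \<in> set_spmf (map_spmf snd \<mu>R)"
      using that by (force simp: image_iff)
    then show False
      unfolding marg(2) by auto
  qed
  have "measure (measure_spmf \<mu>R) X \<le> measure (measure_spmf \<mu>R) (snd -` Some ` T)"
    using no_None unfolding X_def by (intro measure_spmf_mono_on_support) force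
  also have "\<dots> = measure (measure_spmf (map_spmf Some \<mu>2)) (Some ` T)"
    by (simp add: marg(2)[symmetric] measure_map_spmf)
  also have "\<dots> = measure (measure_spmf \<mu>2) T"
    by (simp add: measure_map_spmf inj_vimage_image_eq)
  finally have "exp \<epsilon> * measure (measure_spmf \<mu>R) X \<le> exp \<epsilon> * measure (measure_spmf \<mu>2) T"
    by simp
  moreover have "X \<subseteq> star_set A1 \<times> star_set A2"
    using assms(2,3) by (auto simp: X_def star_set_def)
  then have "measure (measure_spmf \<mu>L) X - exp \<epsilon> * measure (measure_spmf \<mu>R) X \<le> \<delta>"
    by (rule order_trans[OF eps_dist_upper dist])
  ultimately show ?thesis
    using left by linarith
qed

section \<open>Witnesses built from kernels\<close>

text \<open>
  Since \<open>'b spmf = 'b option pmf\<close>, the mass missing from a kernel \<open>K a\<close> is exactly what has to be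
  sent to the fresh element: it suffices to read \<open>K a\<close> as a total distribution on \<open>'b option\<close>.
\<close>

definition star_pair :: "'a spmf \<Rightarrow> ('a \<Rightarrow> 'b spmf) \<Rightarrow> ('a option \<times> 'b option) spmf" where
  "star_pair \<mu> K = bind_spmf \<mu> (\<lambda>a. map_spmf (Pair (Some a)) (spmf_of_pmf (K a)))"

text \<open>Each kernel is read as a total distribution, so no mass of \<open>\<mu>\<close> is lost
  even where \<open>K a\<close> has weight below 1.\<close>

lemma map_fst_star_pair: "map_spmf fst (star_pair \<mu> K) = map_spmf Some \<mu>"
proof -
  have "map_spmf fst (map_spmf (Pair (Some a)) (spmf_of_pmf (K a))) = return_spmf (Some a)" for a
    by (simp add: pmf.map_comp o_def)
  then show ?thesis
    by (simp add: star_pair_def map_spmf_bind_spmf o_def map_spmf_conv_bind_spmf[of Some])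
qed

lemma set_star_pair:
  "set_spmf (star_pair \<mu> K) = {(Some a, y) | a y. a \<in> set_spmf \<mu> \<and> y \<in> set_pmf (K a)}"
  by (auto simp: star_pair_def set_bind_spmf image_iff)

lemma spmf_star_pair: "spmf (star_pair \<mu> K) (Some a, y) = spmf \<mu> a * pmf (K a) y"
proof -
  \<comment> \<open>A pair with first entry \<open>Some a\<close> is produced only by the kernel at
    \<open>a\<close>, so the integrand is concentrated at one point.\<close>
  have "spmf (map_spmf (Pair (Some x)) (spmf_of_pmf (K x))) (Some a, y)
      = pmf (K a) y * indicator {a} x" for x
  proof (cases "x = a")
    case True
    then show ?thesis
      by (simp add: pmf_map_inj' inj_on_def)
  next
    case False
    then show ?thesis
      by (auto simp: pmf_eq_0_set_pmf)
  qed
  then have "spmf (star_pair \<mu> K) (Some a, y)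
      = (\<integral>x. pmf (K a) y * indicator {a} x \<partial>measure_spmf \<mu>)"
    by (simp only: star_pair_def spmf_bind)
  then show ?thesis
    by (simp add: spmf_conv_measure_spmf[of \<mu>])
qed

text \<open>The second coordinate \<open>None\<close> collects the missing mass of every kernel. For
  the left witness this total will bound the distance.\<close>

lemma measure_star_pair_None:
  "measure (measure_spmf (star_pair \<mu> K)) (UNIV \<times> {None}) = (\<integral>a. pmf (K a) None \<partial>measure_spmf \<mu>)"
proof -
  have "measure (measure_spmf (star_pair \<mu> K)) (UNIV \<times> {None})
      = spmf (map_spmf snd (star_pair \<mu> K)) None"
    by (auto simp: spmf_conv_measure_spmf measure_map_spmf intro!: arg_cong[where f="measure _"])
  also have "map_spmf snd (star_pair \<mu> K) = bind_spmf \<mu> (\<lambda>a. spmf_of_pmf (K a))"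
    by (simp add: star_pair_def map_spmf_bind_spmf o_def pmf.map_comp)
  finally show ?thesis
    by (simp add: spmf_bind)
qed

text \<open>\<open>scale_spmf\<close> caps its factor at the inverse of the weight. The second
  assumption keeps \<open>k\<close> below this cap, so the scaling is literal.\<close>

lemma
  assumes "0 \<le> k" and "k * measure (measure_spmf \<mu>) B \<le> 1"
  shows spmf_scale_restrict_spmf:
      "spmf (scale_spmf k (\<mu> \<upharpoonleft> B)) x = k * indicator B x * spmf \<mu> x"
    and pmf_scale_restrict_spmf_None:
      "pmf (scale_spmf k (\<mu> \<upharpoonleft> B)) None = 1 - k * measure (measure_spmf \<mu>) B"
proof -
  have *: "k \<le> inverse (measure (measure_spmf \<mu>) B)" if "measure (measure_spmf \<mu>) B \<noteq> 0"
    using assms that by (simp add: field_simps zero_less_measure_iff)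
  show "spmf (scale_spmf k (\<mu> \<upharpoonleft> B)) x = k * indicator B x * spmf \<mu> x"
  proof (cases "measure (measure_spmf \<mu>) B = 0")
    \<comment> \<open>The cap is \<open>inverse 0 = 0\<close> here, so the factor need not be
      \<open>k\<close>; both sides vanish because \<open>\<mu>\<close> has no mass on
      \<open>B\<close>.\<close>
    case True
    have "spmf \<mu> x = 0" if "x \<in> B"
      using spmf_le_weight[of "\<mu> \<upharpoonleft> B" x] True that by simp
    then show ?thesis
      by (auto simp: spmf_scale_spmf spmf_restrict_spmf indicator_def)
  next
    case False
    then show ?thesis
      using * assms(1)
      by (auto simp: spmf_scale_spmf spmf_restrict_spmf indicator_def
          min_def max_def)
  qed
  show "pmf (scale_spmf k (\<mu> \<upharpoonleft> B)) None = 1 - k * measure (measure_spmf \<mu>) B"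
    using assms by (simp add: pmf_None_eq_weight_spmf weight_scale_spmf)
qed

section \<open>From the two inequalities to a lifting\<close>

lemma approx_lifting_blocks:
  fixes \<alpha> \<delta> :: real and \<mu>1 :: "'a spmf" and \<mu>2 :: "'b spmf"
  assumes \<alpha>: "\<alpha> \<ge> 1" and \<delta>: "\<delta> \<ge> 0"
    and sub1: "set_spmf \<mu>1 \<subseteq> A1" and sub2: "set_spmf \<mu>2 \<subseteq> A2"
    and weight: "measure (measure_spmf \<mu>1) A1 = measure (measure_spmf \<mu>2) A2"
    and S: "S1 \<subseteq> A1" "S2 \<subseteq> A2"
    and le1: "measure (measure_spmf \<mu>1) S1 \<le> \<alpha> * measure (measure_spmf \<mu>2) S2 + \<delta>"
    and le2: "measure (measure_spmf \<mu>1) (A1 - S1) \<le> \<alpha> * measure (measure_spmf \<mu>2) (A2 - S2) + \<delta>"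
  shows "approx_lifting A1 A2 (ln \<alpha>) \<delta>
            {(a1, a2). a1 \<in> A1 \<and> a2 \<in> A2 \<and> (a1 \<in> S1 \<longleftrightarrow> a2 \<in> S2)} \<mu>1 \<mu>2"
proof -
  \<comment> \<open>\<open>True\<close> indexes the block \<open>S1 \<times> S2\<close> and
    \<open>False\<close> the block of the complements.\<close>
  define C1 where "C1 c = (if c then S1 else A1 - S1)" for c
  define C2 where "C2 c = (if c then S2 else A2 - S2)" for c
  define p where "p c = measure (measure_spmf \<mu>1) (C1 c)" for c
  define q where "q c = measure (measure_spmf \<mu>2) (C2 c)" for c
  \<comment> \<open>Unless the maximum is 0, this is the largest factor for which the kernels
    \<open>K1\<close> and \<open>K2\<close> below have weight at most 1 on the block.\<close>
  define r where "r c = 1 / max (p c) (\<alpha> * q c)" for c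
  have nonneg: "0 \<le> p c" "0 \<le> q c" for c
    by (simp_all add: p_def q_def)
  have r: "0 \<le> r c" "r c * p c \<le> 1" "\<alpha> * r c * q c \<le> 1" for c
  proof -
    show "0 \<le> r c"
      using nonneg[of c] by (simp add: r_def le_max_iff_disj)
    show "r c * p c \<le> 1" "\<alpha> * r c * q c \<le> 1"
      using nonneg[of c] \<alpha> by (auto simp: r_def max_def divide_simps)
  qed
  \<comment> \<open>If \<open>p c \<le> \<alpha> * q c\<close>, then the first factor or
    \<open>p c\<close> is 0; otherwise \<open>r c = 1 / p c\<close>.\<close>
  have rest: "(1 - \<alpha> * r c * q c) * p c = max (p c - \<alpha> * q c) 0" for c
    using nonneg[of c] \<alpha> by (auto simp: r_def max_def field_simps)
  define K1 where "K1 a = scale_spmf (\<alpha> * r (a \<in> S1)) (\<mu>2 \<upharpoonleft> C2 (a \<in> S1))" for a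
  define K2 where "K2 b = scale_spmf (r (b \<in> S2)) (\<mu>1 \<upharpoonleft> C1 (b \<in> S2))" for b
  have K1_Some: "spmf (K1 a) b = \<alpha> * r (a \<in> S1) * indicator (C2 (a \<in> S1)) b * spmf \<mu>2 b" for a b
    unfolding K1_def by (rule spmf_scale_restrict_spmf) (use r \<alpha> q_def in auto)
  have K1_None: "pmf (K1 a) None = 1 - \<alpha> * r (a \<in> S1) * q (a \<in> S1)" for a
    unfolding K1_def q_def
    by (rule pmf_scale_restrict_spmf_None) (use r \<alpha> in \<open>auto simp: q_def\<close>)
  have K2_Some: "spmf (K2 b) a = r (b \<in> S2) * indicator (C1 (b \<in> S2)) a * spmf \<mu>1 a" for a b
    unfolding K2_def by (rule spmf_scale_restrict_spmf) (use r p_def in auto)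
  define \<mu>L where "\<mu>L = star_pair \<mu>1 K1"
  \<comment> \<open>\<open>star_pair\<close> fixes the first marginal, so the right witness, whose
    second marginal is prescribed, is built with the sides exchanged.\<close>
  define \<mu>R where "\<mu>R = map_spmf prod.swap (star_pair \<mu>2 K2)"
  have spmf_L: "spmf \<mu>L (Some a, y) = spmf \<mu>1 a * pmf (K1 a) y" for a y
    by (simp add: \<mu>L_def spmf_star_pair)
  have spmf_R: "spmf \<mu>R (x, Some b) = spmf \<mu>2 b * pmf (K2 b) x" for x b
    using spmf_map_inj'[of prod.swap "star_pair \<mu>2 K2" "(Some b, x)"]
    by (simp add: \<mu>R_def spmf_star_pair)
  let ?Q = "{(a1, a2). a1 \<in> A1 \<and> a2 \<in> A2 \<and> (a1 \<in> S1 \<longleftrightarrow> a2 \<in> S2)}"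
  have supp_L: "set_spmf \<mu>L \<subseteq> star_rel A1 A2 ?Q"
  proof
    fix z assume "z \<in> set_spmf \<mu>L"
    then obtain a y where z: "z = (Some a, y)" "a \<in> set_spmf \<mu>1" "y \<in> set_pmf (K1 a)"
      by (auto simp: \<mu>L_def set_star_pair)
    show "z \<in> star_rel A1 A2 ?Q"
    proof (cases y)
      case None
      then show ?thesis
        using z sub1 by (auto simp: star_rel_def)
    next
      case (Some b)
      then have "spmf (K1 a) b \<noteq> 0"
        using z(3) by (simp add: set_pmf_iff)
      then have "b \<in> C2 (a \<in> S1)"
        by (auto simp: K1_Some indicator_def split: if_splits)
      then show ?thesis
        using z Some S sub1 by (auto simp: star_rel_def C2_def image_iff split: if_splits)
    qed
  qed
  have supp_R: "set_spmf \<mu>R \<subseteq> star_rel A1 A2 ?Q"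
  proof
    fix z assume "z \<in> set_spmf \<mu>R"
    then obtain x b where z: "z = (x, Some b)" "b \<in> set_spmf \<mu>2" "x \<in> set_pmf (K2 b)"
      by (auto simp: \<mu>R_def set_star_pair)
    show "z \<in> star_rel A1 A2 ?Q"
    proof (cases x)
      case None
      then show ?thesis
        using z sub2 by (auto simp: star_rel_def)
    next
      case (Some a)
      then have "spmf (K2 b) a \<noteq> 0"
        using z(3) by (simp add: set_pmf_iff)
      then have "a \<in> C1 (b \<in> S2)"
        by (auto simp: K2_Some indicator_def split: if_splits)
      then show ?thesis
        using z Some S sub2 by (auto simp: star_rel_def C1_def image_iff split: if_splits)
    qed
  qed
  have star_sub: "star_rel A1 A2 ?Q \<subseteq> star_set A1 \<times> star_set A2"
    by (auto simp: star_rel_def star_set_def)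
  have "measure (measure_spmf \<mu>L) (UNIV \<times> {None}) = (\<integral>a. pmf (K1 a) None \<partial>measure_spmf \<mu>1)"
    by (simp add: \<mu>L_def measure_star_pair_None)
  \<comment> \<open>Almost every \<open>a\<close> lies in \<open>A1\<close>, hence in exactly one
    block, and the missing mass of \<open>K1 a\<close> is constant on each block.\<close>
  also have "\<dots> = (\<integral>a. (1 - \<alpha> * r True * q True) * indicator (C1 True) a
      + (1 - \<alpha> * r False * q False) * indicator (C1 False) a \<partial>measure_spmf \<mu>1)"
    using sub1 by (intro integral_cong_AE) (auto simp: K1_None C1_def indicator_def)
  also have "\<dots> = (1 - \<alpha> * r True * q True) * p True + (1 - \<alpha> * r False * q False) * p False"
    by (subst Bochner_Integration.integral_add)
      (auto simp: p_def integrable_real_mult_indicator measure_spmf.emeasure_eq_measure)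
  also have "\<dots> \<le> \<delta>"
  proof -
    have "p True + p False = measure (measure_spmf \<mu>1) A1"
      using measure_spmf.finite_measure_Diff[of A1 \<mu>1 S1] S by (simp add: p_def C1_def)
    moreover have "q True + q False = measure (measure_spmf \<mu>2) A2"
      using measure_spmf.finite_measure_Diff[of A2 \<mu>2 S2] S by (simp add: q_def C2_def)
    ultimately have "p True + p False = q True + q False"
      using weight by simp
    moreover have "1 * (q True + q False) \<le> \<alpha> * (q True + q False)"
      using nonneg \<alpha> by (intro mult_right_mono) auto
    ultimately have "(p True - \<alpha> * q True) + (p False - \<alpha> * q False) \<le> 0"
      by (simp add: algebra_simps)
    moreover have "p True - \<alpha> * q True \<le> \<delta>" "p False - \<alpha> * q False \<le> \<delta>"
      using le1 le2 by (simp_all add: p_def q_def C1_def C2_def)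
    ultimately show ?thesis
      unfolding rest using \<delta> by linarith
  qed
  finally have excess: "measure (measure_spmf \<mu>L) (UNIV \<times> {None}) \<le> \<delta>" .
  have "eps_dist (star_set A1 \<times> star_set A2) (ln \<alpha>) \<mu>L \<mu>R \<le> \<delta>"
  proof (rule eps_dist_least)
    fix X :: "('a option \<times> 'b option) set"
    \<comment> \<open>The left witness has no mass in the row \<open>None\<close>, so outside
      \<open>?Y\<close> it only charges the column \<open>None\<close>, whose mass is at most
      \<open>\<delta>\<close>.\<close>
    let ?Y = "X \<inter> range Some \<times> range Some"
    have "measure (measure_spmf \<mu>L) X \<le> measure (measure_spmf \<mu>L) (?Y \<union> UNIV \<times> {None})"
    proof (rule measure_spmf_mono_on_support)
      fix z assume "z \<in> set_spmf \<mu>L" "z \<in> X"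
      moreover from this obtain a y where "z = (Some a, y)"
        by (auto simp: \<mu>L_def set_star_pair)
      ultimately show "z \<in> ?Y \<union> UNIV \<times> {None}"
        by (cases y) auto
    qed
    also have "\<dots> \<le> measure (measure_spmf \<mu>L) ?Y + measure (measure_spmf \<mu>L) (UNIV \<times> {None})"
      by (rule measure_Un_le) auto
    also have "measure (measure_spmf \<mu>L) ?Y \<le> \<alpha> * measure (measure_spmf \<mu>R) ?Y"
    proof (rule measure_spmf_le_of_spmf_le)
      fix z assume "z \<in> ?Y"
      then obtain a b where z: "z = (Some a, Some b)"
        by auto
      show "spmf \<mu>L z \<le> \<alpha> * spmf \<mu>R z"
      \<comment> \<open>Within a block the two sides are equal; elsewhere the left one is 0.\<close>
      proof (cases "a \<in> set_spmf \<mu>1 \<and> b \<in> C2 (a \<in> S1)")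
        case True
        then have "(b \<in> S2) = (a \<in> S1)" "a \<in> C1 (a \<in> S1)"
          using sub1 by (auto simp: C1_def C2_def split: if_splits)
        then show ?thesis
          using True by (simp add: z spmf_L spmf_R K1_Some K2_Some)
      next
        case False
        then have "spmf \<mu>L z = 0"
          by (auto simp: z spmf_L K1_Some spmf_eq_0_set_spmf)
        then show ?thesis
          using \<alpha> by simp
      qed
    qed (use \<alpha> in simp)
    also have "measure (measure_spmf \<mu>R) ?Y \<le> measure (measure_spmf \<mu>R) X"
      by (rule measure_spmf_mono_on_support) auto
    finally show "measure (measure_spmf \<mu>L) X \<le> exp (ln \<alpha>) * measure (measure_spmf \<mu>R) X + \<delta>"
      using excess \<alpha> by (simp add: mult_left_mono)
  qed
  moreover have "map_spmf fst \<mu>L = map_spmf Some \<mu>1"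
    by (simp add: \<mu>L_def map_fst_star_pair)
  moreover have "map_spmf snd \<mu>R = map_spmf Some \<mu>2"
    by (simp add: \<mu>R_def spmf.map_comp o_def map_fst_star_pair)
  ultimately show ?thesis
    unfolding approx_lifting_def subdist_on_def using supp_L supp_R star_sub by blast
qed

theorem theorem5p16:
  fixes \<alpha> \<delta> :: real
    and A1 S1 :: "'a set" and A2 S2 :: "'b set"
    and \<mu>1 :: "'a spmf" and \<mu>2 :: "'b spmf"
  assumes "\<alpha> \<ge> 1" and "\<delta> \<ge> 0"
    and "countable A1" and "countable A2"
    and "subdist_on A1 \<mu>1" and "subdist_on A2 \<mu>2"
    and "measure (measure_spmf \<mu>1) A1 = measure (measure_spmf \<mu>2) A2"
    and "S1 \<subseteq> A1" and "S2 \<subseteq> A2"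
  shows "(measure (measure_spmf \<mu>1) S1 \<le> \<alpha> * measure (measure_spmf \<mu>2) S2 + \<delta> \<and>
          measure (measure_spmf \<mu>1) (A1 - S1) \<le> \<alpha> * measure (measure_spmf \<mu>2) (A2 - S2) + \<delta>)
     \<longleftrightarrow> approx_lifting A1 A2 (ln \<alpha>) \<delta>
            {(a1, a2). a1 \<in> A1 \<and> a2 \<in> A2 \<and> (a1 \<in> S1 \<longleftrightarrow> a2 \<in> S2)} \<mu>1 \<mu>2"
proof
  assume "measure (measure_spmf \<mu>1) S1 \<le> \<alpha> * measure (measure_spmf \<mu>2) S2 + \<delta> \<and>
          measure (measure_spmf \<mu>1) (A1 - S1) \<le> \<alpha> * measure (measure_spmf \<mu>2) (A2 - S2) + \<delta>"
  then show "approx_lifting A1 A2 (ln \<alpha>) \<delta>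
            {(a1, a2). a1 \<in> A1 \<and> a2 \<in> A2 \<and> (a1 \<in> S1 \<longleftrightarrow> a2 \<in> S2)} \<mu>1 \<mu>2"
    using assms by (intro approx_lifting_blocks) (auto simp: subdist_on_def)
next
  assume lift: "approx_lifting A1 A2 (ln \<alpha>) \<delta>
            {(a1, a2). a1 \<in> A1 \<and> a2 \<in> A2 \<and> (a1 \<in> S1 \<longleftrightarrow> a2 \<in> S2)} \<mu>1 \<mu>2"
  \<comment> \<open>The relation sends \<open>S1\<close> into \<open>S2\<close> and
    \<open>A1 - S1\<close> into \<open>A2 - S2\<close>, so the mass inequality applies to both
    pairs.\<close>
  have "exp (ln \<alpha>) = \<alpha>"
    using assms(1) by simp
  then show "measure (measure_spmf \<mu>1) S1 \<le> \<alpha> * measure (measure_spmf \<mu>2) S2 + \<delta> \<and>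
          measure (measure_spmf \<mu>1) (A1 - S1) \<le> \<alpha> * measure (measure_spmf \<mu>2) (A2 - S2) + \<delta>"
    using approx_lifting_measure_le[OF lift, of S1 S2]
      approx_lifting_measure_le[OF lift, of "A1 - S1" "A2 - S2"] assms(8,9)
    by auto
qed

end
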